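(* Consider the wireless MapReduce system with $K$ nodes, $N\ge K$ files and $Q$ Reduce functions ($K\mid Q$), with a channel matrix $(h_{k,i})\in\mathbb{C}^{K\times K}$ all of whose submatrices have full rank, under one-shot linear schemes (as defined in the context). Let $r$ be a real number with $1\le r\le K$. Then for every achievable pair $(r,L)$ (where different files may be replicated at different numbers of nodes, with average replication $r$), $$L\ \ge\ \frac{1-\frac{r}{K}}{\min\{K,2r\}},$$ that is, $L^*(r)\ge \frac{1-\frac{r}{K}}{\min\{K,2r\}}$.
   Context: Notation: $[a:b]$ is the set of integers from $a$ to $b$. **System.** There are $K$ nodes, $N\ge K$ independent files $w_1,\dots,w_N$, and $Q$ Reduce functions, with $Q/K\in\mathbb{N}$. *Map phase.* Node $k$ is assigned the files with indices in a set $\mathcal{M}_k\subseteq[1:N]$ (chosen by the scheme). From each file $w_n$, $n\in\mathcal{M}_k$, it computes $Q$ intermediate values $a_{q,n}\in\mathbb{F}_2^B$, $q\in[1:Q]$. The computation load is $r=\frac1N\sum_{k=1}^K|\mathcal{M}_k|$, i.e. the average number of nodes at which a file is stored. *Reduce assignment.* Node $k$ must compute the Reduce functions indexed by $\mathcal{W}_k\subseteq[1:Q]$, where $\mathcal{W}_1,\dots,\mathcal{W}_K$ are pairwise disjoint with $|\mathcal{W}_k|=Q/K$ (so they partition $[1:Q]$). Reduce function $q$ is a function of $(a_{q,1},\dots,a_{q,N})$. Hence Node $k$ already has $\mathcal{P}_k=\{a_{q,n}:q\in[1:Q],\,n\in\mathcal{M}_k\}$ and requires $\mathcal{G}_k=\{a_{q,n}:q\in\mathcal{W}_k,\,n\in[1:N]\setminus\mathcal{M}_k\}$.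 *Channel.* At each channel use $t$, $y_k(t)=\sum_{i=1}^K h_{k,i}x_i(t)+z_k(t)$, with power constraint $\mathbb{E}[|x_k(t)|^2]\le P$ and noise $z_k(t)\sim\mathcal{CN}(0,1)$. The coefficients $h_{k,i}\in\mathbb{C}$ are fixed, known to all nodes, bounded in absolute value and bounded away from zero, and every submatrix of $(h_{k,i})$ has full rank. Communication is full-duplex (every node can transmit and receive simultaneously). *Shuffle phase (one-shot linear scheme).* Each intermediate value $a_{q,n}$ is encoded by a random Gaussian code into a coded packet $\tilde{\boldsymbol a}_{q,n}\in\mathbb{C}^\tau$ occupying one block of $\tau$ channel uses, with $B=\tau\log P+o(\tau\log P)$. Transmission takes place over $T$ blocks. In block $\ell\in[1:T]$ a set $\mathcal{D}_\ell$ of required packets is delivered to a set $\mathcal{R}_\ell\subseteq[1:K]$ of receivers, $|\mathcal{D}_\ell|=|\mathcal{R}_\ell|$, each packet being intended for one receiver of $\mathcal{R}_\ell$ (a different receiver for each packet) which requires it. The sets $\mathcal{D}_1,\dots,\mathcal{D}_T$ are pairwise disjoint and together contain all required packets, i.e. all $\tilde{\boldsymbol a}_{q,n}$ with $a_{q,n}\in\bigcup_k\mathcal{G}_k$. In block $\ell$, Node $i$ transmits $$\boldsymbol x_i[\ell]=\sum_{(q,n):\ \tilde{\boldsymbol a}_{q,n}\in\mathcal{D}_\ell,\ n\in\mathcal{M}_i}\beta_{i,q,n}\,\tilde{\boldsymbol a}_{q,n}\in\mathbb{C}^\tau$$ with beamforming coefficients $\beta_{i,q,n}\in\mathbb{C}$,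 and Node $k$ receives $\boldsymbol y_k[\ell]=\sum_{i=1}^K h_{k,i}\boldsymbol x_i[\ell]+\boldsymbol z_k[\ell]$. Block $\ell$ is *successful* if the coefficients $\beta_{i,q,n}$ can be chosen so that for each $k\in\mathcal{R}_\ell$ there is a linear function $\mathcal{L}_{k,\ell}$ of $\boldsymbol y_k[\ell]$ and of the packets cached at Node $k$, $\tilde{\mathcal{P}}_k=\{\tilde{\boldsymbol a}_{q,n}:a_{q,n}\in\mathcal{P}_k\}$, with $$\mathcal{L}_{k,\ell}(\boldsymbol y_k[\ell],\tilde{\mathcal{P}}_k)=\tilde{\boldsymbol a}_{q,n}+\boldsymbol z_k[\ell],$$ where $\tilde{\boldsymbol a}_{q,n}\in\mathcal{D}_\ell$ is the packet intended for Node $k$ (the identity is linear in the packets, which are treated as free symbols). In that case $a_{q,n}$ is regarded as decodable at Node $k$ with vanishing error probability as $B\to\infty$ (point-to-point Gaussian channel of capacity about $\log P$). **Loads.** The communication load of a scheme is $L=\frac{T}{NQ}$. The pair $(r,L)$ is achievable (feasible) if there are choices of $\mathcal{M}_k$, $\mathcal{W}_k$ with computation load $r$ and a one-shot linear Shuffle scheme with communication load $L$, all of whose blocks are successful. The computation-communication function is $L^*(r)=\inf\{L:(r,L)\text{ is achievable}\}$ (with $N,K,Q$ and the channel fixed; the infimum of the empty set is $+\infty$). *)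

theory Defs
  imports
    "HOL-Analysis.Analysis"
    "HOL-Library.Extended_Real"
    "Jordan_Normal_Form.DL_Rank"
    "Jordan_Normal_Form.DL_Submatrix"
begin

text \<open>
  Nodes, files, Reduce functions and blocks are numbered from 0, so the index set \<open>[1:K]\<close> becomes
  \<open>{..<K}\<close>, and similarly for \<open>N\<close>, \<open>Q\<close> and \<open>T\<close>. The pair \<open>(q, n)\<close> names the intermediate value of
  Reduce function \<open>q\<close> and file \<open>n\<close>, and also its coded packet. Coded packets take values in
  \<open>complex ^ 't\<close>; the block length is the cardinality of \<open>'t\<close>.
\<close>

type_synonym packet = "nat \<times> nat"

definition all_submatrices_full_rank :: "nat \<Rightarrow> (nat \<Rightarrow> nat \<Rightarrow> complex) \<Rightarrow> bool" where
  "all_submatrices_full_rank K h \<longleftrightarrow>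
     (\<forall>I J. I \<subseteq> {..<K} \<and> J \<subseteq> {..<K} \<and> I \<noteq> {} \<and> J \<noteq> {} \<longrightarrow>
        vec_space.rank (card I) (submatrix (Matrix.mat K K (\<lambda>(k, i). h k i)) I J)
          = min (card I) (card J))"

definition map_assignment :: "nat \<Rightarrow> nat \<Rightarrow> (nat \<Rightarrow> nat set) \<Rightarrow> bool" where
  "map_assignment K N M \<longleftrightarrow> (\<forall>k<K. M k \<subseteq> {..<N})"

definition computation_load :: "nat \<Rightarrow> nat \<Rightarrow> (nat \<Rightarrow> nat set) \<Rightarrow> real" where
  "computation_load K N M = (\<Sum>k<K. real (card (M k))) / real N"

definition reduce_assignment :: "nat \<Rightarrow> nat \<Rightarrow> (nat \<Rightarrow> nat set) \<Rightarrow> bool" where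
  "reduce_assignment K Q W \<longleftrightarrow>
     (\<forall>k<K. W k \<subseteq> {..<Q} \<and> card (W k) = Q div K) \<and> disjoint_family_on W {..<K}"

definition cached :: "nat \<Rightarrow> (nat \<Rightarrow> nat set) \<Rightarrow> nat \<Rightarrow> packet set" where
  "cached Q M k = {..<Q} \<times> M k"

definition required :: "nat \<Rightarrow> (nat \<Rightarrow> nat set) \<Rightarrow> (nat \<Rightarrow> nat set) \<Rightarrow> nat \<Rightarrow> packet set" where
  "required N M W k = W k \<times> ({..<N} - M k)"

definition transmitted ::
  "(nat \<Rightarrow> nat set) \<Rightarrow> packet set \<Rightarrow> (nat \<Rightarrow> packet \<Rightarrow> complex) \<Rightarrow> (packet \<Rightarrow> complex ^ 't::finite)
     \<Rightarrow> nat \<Rightarrow> complex ^ 't" where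
  "transmitted M D \<beta> a i = (\<Sum>p\<in>{p \<in> D. snd p \<in> M i}. \<beta> i p *s a p)"

definition received ::
  "nat \<Rightarrow> (nat \<Rightarrow> nat \<Rightarrow> complex) \<Rightarrow> (nat \<Rightarrow> nat set) \<Rightarrow> packet set \<Rightarrow> (nat \<Rightarrow> packet \<Rightarrow> complex)
     \<Rightarrow> (packet \<Rightarrow> complex ^ 't::finite) \<Rightarrow> (nat \<Rightarrow> complex ^ 't) \<Rightarrow> nat \<Rightarrow> complex ^ 't" where
  "received K h M D \<beta> a z k = (\<Sum>i<K. h k i *s transmitted M D \<beta> a i) + z k"

text \<open>
  A complex-linear function of a received block and of the packets in the finite set \<open>S\<close>, written
  as the sum of its restrictions to the individual arguments.
\<close>

definition linear_decoder ::
  "packet set \<Rightarrow> (complex ^ 't::finite \<Rightarrow> (packet \<Rightarrow> complex ^ 't) \<Rightarrow> complex ^ 't) \<Rightarrow> bool" where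
  "linear_decoder S \<Lambda> \<longleftrightarrow>
     (\<exists>A C. Vector_Spaces.linear (*s) (*s) A \<and>
            (\<forall>p\<in>S. Vector_Spaces.linear (*s) (*s) (C p)) \<and>
            (\<forall>y a. \<Lambda> y a = A y + (\<Sum>p\<in>S. C p (a p))))"

text \<open>
  \<open>D\<close> is the set of packets of the block, \<open>R\<close> its set of receivers and \<open>d k\<close> the packet intended
  for \<open>k \<in> R\<close>. Packets and noise are free symbols: the coefficients \<open>\<beta>\<close> and the decoder \<open>\<Lambda>\<close> are
  chosen before the values \<open>a\<close> and \<open>z\<close>.
\<close>

definition block_successful ::
  "'t::finite itself \<Rightarrow> nat \<Rightarrow> nat \<Rightarrow> (nat \<Rightarrow> nat \<Rightarrow> complex) \<Rightarrow> (nat \<Rightarrow> nat set) \<Rightarrow> packet set \<Rightarrow> nat set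
     \<Rightarrow> (nat \<Rightarrow> packet) \<Rightarrow> bool" where
  "block_successful _ K Q h M D R d \<longleftrightarrow>
     (\<exists>\<beta>. \<forall>k\<in>R. \<exists>\<Lambda>. linear_decoder (cached Q M k) \<Lambda> \<and>
        (\<forall>(a :: packet \<Rightarrow> complex ^ 't) z.
           \<Lambda> (received K h M D \<beta> a z k) a = a (d k) + z k))"

definition one_shot_linear_scheme ::
  "'t::finite itself \<Rightarrow> nat \<Rightarrow> nat \<Rightarrow> nat \<Rightarrow> (nat \<Rightarrow> nat \<Rightarrow> complex) \<Rightarrow> (nat \<Rightarrow> nat set) \<Rightarrow> (nat \<Rightarrow> nat set)
     \<Rightarrow> nat \<Rightarrow> (nat \<Rightarrow> packet set) \<Rightarrow> (nat \<Rightarrow> nat set) \<Rightarrow> (nat \<Rightarrow> nat \<Rightarrow> packet) \<Rightarrow> bool" where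
  "one_shot_linear_scheme \<tau> K N Q h M W T D R d \<longleftrightarrow>
     (\<forall>l<T. R l \<subseteq> {..<K} \<and>
            bij_betw (d l) (R l) (D l) \<and>
            (\<forall>k\<in>R l. d l k \<in> required N M W k) \<and>
            block_successful \<tau> K Q h M (D l) (R l) (d l)) \<and>
     disjoint_family_on D {..<T} \<and>
     (\<Union>k<K. required N M W k) \<subseteq> (\<Union>l<T. D l)"

definition achievable ::
  "'t::finite itself \<Rightarrow> nat \<Rightarrow> nat \<Rightarrow> nat \<Rightarrow> (nat \<Rightarrow> nat \<Rightarrow> complex) \<Rightarrow> real \<Rightarrow> real \<Rightarrow> bool" where
  "achievable \<tau> K N Q h r L \<longleftrightarrow>
     (\<exists>M W T D R d. map_assignment K N M \<and> reduce_assignment K Q W \<and>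
        computation_load K N M = r \<and>
        one_shot_linear_scheme \<tau> K N Q h M W T D R d \<and>
        L = real T / (real N * real Q))"

definition comp_comm_function ::
  "'t::finite itself \<Rightarrow> nat \<Rightarrow> nat \<Rightarrow> nat \<Rightarrow> (nat \<Rightarrow> nat \<Rightarrow> complex) \<Rightarrow> real \<Rightarrow> ereal" where
  "comp_comm_function \<tau> K N Q h r = (INF L\<in>{L. achievable \<tau> K N Q h r L}. ereal L)"

end

theory Submission
  imports Defs
begin

text \<open>
  Let file \<open>n\<close> be stored at \<open>s\<close> nodes. If a packet of file \<open>n\<close> is delivered in a block with receiver
  set \<open>R\<close>, then each receiver that neither wants nor caches the packet sees it with coefficient 0.
  These are linear equations in the \<open>s\<close> beamforming coefficients of the packet; as the submatrices of
  the channel matrix have full rank, \<open>s\<close> such equations would switch the packet off altogether. Hence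
  \<open>card R \<le> 1 + (s - 1) + s = 2 * s\<close>. Giving each required packet the weight
  \<open>1 / (2 * s)\<close> (or \<open>1 / K\<close>), every block carries total weight at most 1, so the
  total weight is a lower bound for the number of blocks; convexity of \<open>1 / s\<close> replaces \<open>s\<close> by its
  average \<open>r\<close>.
\<close>

section \<open>Zero forcing and the number of receivers of one block\<close>

definition replication :: "nat \<Rightarrow> (nat \<Rightarrow> nat set) \<Rightarrow> nat \<Rightarrow> nat" where
  "replication K M n = card {i. i < K \<and> n \<in> M i}"

text \<open>Entries of \<open>submatrix\<close> are addressed by position; this enumeration turns
  sums over positions into sums over the index set.\<close>

lemma bij_betw_pick:
  assumes "finite J"
  shows "bij_betw (pick J) {..<card J} J"
proof (rule bij_betw_imageI)
  show inj: "inj_on (pick J) {..<card J}"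
    by (rule inj_on_inverseI[where g = "\<lambda>x. card {a \<in> J. a < x}"]) (simp add: card_pick)
  have "pick J ` {..<card J} \<subseteq> J"
    by (auto intro: pick_in_set_le)
  then show "pick J ` {..<card J} = J"
    by (rule card_subset_eq[OF assms]) (simp add: card_image[OF inj])
qed

text \<open>With \<open>card S\<close> or more nulling rows, the channel matrix would have a square
  submatrix of full rank annihilating \<open>b\<close> on \<open>S\<close>, so \<open>b\<close>
  would vanish there and nothing could reach \<open>k\<close>. Here \<open>b\<close> plays the
  beamforming vector of one packet and \<open>S\<close> the nodes storing its file.\<close>

lemma nulling_constraints_less_unknowns:
  assumes full: "all_submatrices_full_rank K h"
    and J: "J \<subseteq> {..<K}" and S: "S \<subseteq> {..<K}"
    and null: "\<And>j. j \<in> J \<Longrightarrow> (\<Sum>i\<in>S. h j i * b i) = 0"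
    and nz: "(\<Sum>i\<in>S. h k i * b i) \<noteq> 0"
  shows "card J < card S"
proof (rule ccontr)
  assume "\<not> card J < card S"
  then obtain I where I: "I \<subseteq> J" "card I = card S"
    by (meson linorder_not_le obtain_subset_with_card_n)
  have fS: "finite S" using S by (rule finite_subset) simp
  \<comment> \<open>The rank hypothesis speaks only of nonempty index sets.\<close>
  have "S \<noteq> {}" using nz by auto
  then have "I \<noteq> {}" using I fS by auto
  define A where "A = submatrix (Matrix.mat K K (\<lambda>(k, i). h k i)) I S"
  have "vec_space.rank (card S) A = card S"
    using full J S I \<open>S \<noteq> {}\<close> \<open>I \<noteq> {}\<close>
    unfolding all_submatrices_full_rank_def A_def by (metis min.idem order_trans)
  moreover have dims: "card {i. i < K \<and> i \<in> I} = card S" "card {i. i < K \<and> i \<in> S} = card S"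
  proof -
    have "{i. i < K \<and> i \<in> I} = I" "{i. i < K \<and> i \<in> S} = S" using I J S by auto
    then show "card {i. i < K \<and> i \<in> I} = card S" "card {i. i < K \<and> i \<in> S} = card S"
      using I by auto
  qed
  then have A: "A \<in> carrier_mat (card S) (card S)"
    unfolding A_def by (simp add: carrier_matI dim_submatrix)
  ultimately have det: "Determinant.det A \<noteq> 0"
    using vec_space.det_rank_iff by blast
  define v where "v = vec (card S) (\<lambda>j. b (pick S j))"
  have entry: "A $$ (a, c) = h (pick I a) (pick S c)" if "a < card S" "c < card S" for a c
  proof -
    have "pick I a \<in> I" "pick S c \<in> S" using that I by (auto intro: pick_in_set)
    then have "pick I a < K" "pick S c < K" using I J S by auto
    then show ?thesis
      unfolding A_def by (subst submatrix_index) (use that dims in auto)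
  qed
  \<comment> \<open>Row \<open>a\<close> of this system is the nulling equation at node
    \<open>pick I a\<close>.\<close>
  have "A *\<^sub>v v = 0\<^sub>v (card S)"
  proof (rule eq_vecI)
    fix a assume "a < dim_vec (0\<^sub>v (card S) :: complex Matrix.vec)"
    then have a: "a < card S" by simp
    have "(A *\<^sub>v v) $ a = (\<Sum>c<card S. h (pick I a) (pick S c) * b (pick S c))"
      using a A by (auto simp: scalar_prod_def v_def entry atLeast0LessThan intro!: sum.cong)
    also have "\<dots> = (\<Sum>i\<in>S. h (pick I a) i * b i)"
      by (rule sum.reindex_bij_betw[OF bij_betw_pick[OF fS]])
    also have "\<dots> = 0"
      using null I a pick_in_set[of a I] by auto
    finally show "(A *\<^sub>v v) $ a = 0\<^sub>v (card S) $ a" using a by simp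
  qed (use A in auto)
  moreover have "v \<in> carrier_vec (card S)" by (simp add: v_def)
  ultimately have v0: "v = 0\<^sub>v (card S)"
    using det det_0_iff_vec_prod_zero_field[OF A] by blast
  have "b i = 0" if "i \<in> S" for i
  proof -
    have "i \<in> pick S ` {..<card S}"
      using bij_betw_imp_surj_on[OF bij_betw_pick[OF fS]] \<open>i \<in> S\<close> by simp
    then obtain c where c: "c < card S" "pick S c = i" by auto
    then show ?thesis using arg_cong[OF v0, of "\<lambda>w. w $ c"] by (simp add: v_def)
  qed
  then show False using nz by simp
qed

text \<open>The decoding identity holds for all symbols, so test inputs reveal the coefficient with
  which \<open>p\<close> arrives at \<open>k\<close>. As \<open>p\<close> is not cached at
  \<open>k\<close>, the decoder cannot cancel it, and this coefficient must already be the one in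
  \<open>a (d k)\<close>.\<close>

lemma decodable_coefficient:
  fixes \<Lambda> :: "complex ^ 't::finite \<Rightarrow> (packet \<Rightarrow> complex ^ 't) \<Rightarrow> complex ^ 't"
  assumes dec: "linear_decoder (cached Q M k) \<Lambda>"
    and id: "\<And>(a :: packet \<Rightarrow> complex ^ 't) z.
               \<Lambda> (received K h M D \<beta> a z k) a = a (d k) + z k"
    and D: "finite D" "p \<in> D" and p: "snd p \<notin> M k"
  shows "(\<Sum>i\<in>{i. i < K \<and> snd p \<in> M i}. h k i * \<beta> i p) = (if d k = p then 1 else 0)"
proof -
  obtain A C where
    C: "\<And>p. p \<in> cached Q M k \<Longrightarrow> Vector_Spaces.linear (*s) (*s) (C p)" and
    L: "\<And>y a. \<Lambda> y a = A y + (\<Sum>p\<in>cached Q M k. C p (a p))"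
    using dec unfolding linear_decoder_def by metis
  have C0: "C p 0 = 0" if "p \<in> cached Q M k" for p
    by (rule module_hom.zero[OF module_hom_linearI[OF C[OF that]]])
  \<comment> \<open>Test input: all packets zero and noise \<open>x\<close>.\<close>
  have "A x = x" for x
    using id[of "\<lambda>_. 0" "\<lambda>_. x"] C0 by (simp add: L received_def transmitted_def)
  \<comment> \<open>Test input: only \<open>p\<close> is nonzero, namely the all-ones vector, so no
    cached packet contributes.\<close>
  moreover define a :: "packet \<Rightarrow> complex ^ 't" where "a = (\<lambda>q. if q = p then 1 else 0)"
  moreover have "(\<Sum>q\<in>cached Q M k. C q (a q)) = 0"
    using p C0 by (intro sum.neutral) (auto simp: a_def cached_def)
  ultimately have "received K h M D \<beta> a (\<lambda>_. 0) k = a (d k)"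
    using id[of a "\<lambda>_. 0"] by (simp add: L)
  moreover have "transmitted M D \<beta> a i = (if snd p \<in> M i then \<beta> i p *s 1 else 0)" for i
  proof -
    have "transmitted M D \<beta> a i = (\<Sum>q\<in>{q \<in> D. snd q \<in> M i}. if q = p then \<beta> i p *s 1 else 0)"
      unfolding transmitted_def by (intro sum.cong) (auto simp: a_def)
    then show ?thesis using D by (simp add: sum.delta)
  qed
  ultimately have "(\<Sum>i<K. h k i *s (if snd p \<in> M i then \<beta> i p *s 1 else 0)) = a (d k)"
    by (simp add: received_def)
  \<comment> \<open>Any coordinate serves to read off the scalar; \<open>undefined\<close> is an
    arbitrary one.\<close>
  then have "vec_nth (\<Sum>i<K. h k i *s (if snd p \<in> M i then \<beta> i p *s 1 else 0)) (undefined :: 't)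
      = vec_nth (a (d k)) undefined"
    by simp
  then have "(\<Sum>i<K. if snd p \<in> M i then h k i * \<beta> i p else 0) = (if d k = p then 1 else 0)"
    by (simp add: a_def if_distrib[of "\<lambda>x. vec_nth x _"] if_distrib[of "\<lambda>x. _ * x"] cong: if_cong)
  moreover have "(\<Sum>i\<in>{i. i < K \<and> snd p \<in> M i}. h k i * \<beta> i p)
      = (\<Sum>i<K. if snd p \<in> M i then h k i * \<beta> i p else 0)"
    by (rule sum.mono_neutral_cong_left) auto
  ultimately show ?thesis by simp
qed

lemma card_receivers_le:
  assumes full: "all_submatrices_full_rank K h"
    and R: "R \<subseteq> {..<K}" and d: "bij_betw d R D"
    and req: "\<And>k. k \<in> R \<Longrightarrow> d k \<in> required N M W k"
    and succ: "block_successful TYPE('t::finite) K Q h M D R d"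
    and p: "p \<in> D"
  shows "card R \<le> 2 * replication K M (snd p)"
proof -
  obtain k where k: "k \<in> R" "d k = p"
    using d p by (auto simp: bij_betw_def)
  have fR: "finite R" using R by (rule finite_subset) simp
  then have fD: "finite D" using bij_betw_finite[OF d] by simp
  define S where "S = {i. i < K \<and> snd p \<in> M i}"
  obtain \<beta> where \<beta>: "\<And>k. k \<in> R \<Longrightarrow> \<exists>\<Lambda>. linear_decoder (cached Q M k) \<Lambda> \<and>
        (\<forall>(a :: packet \<Rightarrow> complex ^ 't) z.
           \<Lambda> (received K h M D \<beta> a z k) a = a (d k) + z k)"
    using succ unfolding block_successful_def by blast
  have coeff: "(\<Sum>i\<in>S. h j i * \<beta> i p) = (if d j = p then 1 else 0)"
    if j: "j \<in> R" "snd p \<notin> M j" for j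
  proof -
    obtain \<Lambda> where "linear_decoder (cached Q M j) \<Lambda>"
      and "\<And>(a :: packet \<Rightarrow> complex ^ 't) z. \<Lambda> (received K h M D \<beta> a z j) a = a (d j) + z j"
      using \<beta>[OF j(1)] by blast
    then show ?thesis
      unfolding S_def using fD p j(2) by (rule decodable_coefficient)
  qed
  define J where "J = {j \<in> R. j \<noteq> k \<and> snd p \<notin> M j}"
  have "snd p \<notin> M k" using req[OF k(1)] k(2) by (auto simp: required_def)
  then have "(\<Sum>i\<in>S. h k i * \<beta> i p) \<noteq> 0" using coeff k by simp
  moreover have "(\<Sum>i\<in>S. h j i * \<beta> i p) = 0" if "j \<in> J" for j
  proof -
    \<comment> \<open>By injectivity of \<open>d\<close>, \<open>k\<close> is the only receiver for
      which \<open>p\<close> is intended.\<close>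
    have "d j \<noteq> p" using that k d by (auto simp: J_def bij_betw_def inj_on_def)
    then show ?thesis using coeff that by (simp add: J_def)
  qed
  ultimately have "card J < card S"
    using full R by (intro nulling_constraints_less_unknowns) (auto simp: J_def S_def)
  \<comment> \<open>A receiver other than \<open>k\<close> and outside \<open>J\<close> stores the
    file of \<open>p\<close>, hence lies in \<open>S\<close>.\<close>
  moreover have "card R \<le> card ({k} \<union> J \<union> S)"
    by (rule card_mono) (use fR R in \<open>auto simp: J_def S_def\<close>)
  moreover have "card ({k} \<union> J \<union> S) \<le> 1 + card J + card S"
    using card_Un_le[of "{k} \<union> J" S] card_Un_le[of "{k}" J] by simp
  ultimately show ?thesis by (simp add: replication_def S_def)
qed

section \<open>Double counting and weights of packets\<close>

lemma sum_replication:
  assumes "map_assignment K N M"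
  shows "(\<Sum>n<N. replication K M n) = (\<Sum>k<K. card (M k))"
proof -
  have "(\<Sum>n<N. replication K M n) = (\<Sum>n<N. \<Sum>k<K. if n \<in> M k then 1 else 0)"
    by (simp add: replication_def sum.If_cases Int_def)
  also have "\<dots> = (\<Sum>k<K. \<Sum>n<N. if n \<in> M k then 1 else 0)"
    by (rule sum.swap)
  also have "\<dots> = (\<Sum>k<K. card (M k))"
    using assms by (intro sum.cong) (auto simp: sum.If_cases map_assignment_def Int_absorb1)
  finally show ?thesis .
qed

text \<open>File \<open>n\<close> is missing at \<open>K - replication K M n\<close> nodes, and each
  of them requires \<open>Q div K\<close> values of it; disjointness of the sets \<open>W k\<close>
  prevents double counting.\<close>

lemma sum_weight_required:
  fixes g :: "nat \<Rightarrow> real"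
  assumes red: "reduce_assignment K Q W"
  shows "(\<Sum>p\<in>(\<Union>k<K. required N M W k). g (snd p))
    = real (Q div K) * (\<Sum>n<N. (real K - real (replication K M n)) * g n)"
proof -
  have W: "finite (W k)" "card (W k) = Q div K" if "k < K" for k
    using red that finite_subset[of "W k" "{..<Q}"] by (simp_all add: reduce_assignment_def)
  have "(\<Sum>p\<in>(\<Union>k<K. required N M W k). g (snd p))
      = (\<Sum>k<K. \<Sum>p\<in>required N M W k. g (snd p))"
  proof (rule sum.UNION_disjoint)
    show "\<forall>i\<in>{..<K}. \<forall>j\<in>{..<K}. i \<noteq> j \<longrightarrow> required N M W i \<inter> required N M W j = {}"
      using red by (fastforce simp: reduce_assignment_def disjoint_family_on_def required_def)
  qed (use W in \<open>auto simp: required_def\<close>)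
  also have "\<dots> = (\<Sum>k<K. real (Q div K) * (\<Sum>n\<in>{..<N} - M k. g n))"
  proof (rule sum.cong)
    fix k assume "k \<in> {..<K}"
    then have "k < K" by simp
    have "(\<Sum>p\<in>required N M W k. g (snd p)) = (\<Sum>q\<in>W k. \<Sum>n\<in>{..<N} - M k. g n)"
      unfolding required_def sum.cartesian_product' by simp
    then show "(\<Sum>p\<in>required N M W k. g (snd p)) = real (Q div K) * (\<Sum>n\<in>{..<N} - M k. g n)"
      using W[OF \<open>k < K\<close>] by simp
  qed simp
  also have "\<dots> = real (Q div K) * (\<Sum>k<K. \<Sum>n<N. if n \<in> M k then 0 else g n)"
    unfolding sum_distrib_left[symmetric]
    by (intro arg_cong2[where f = "(*)"] refl sum.cong sum.mono_neutral_cong_left) auto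
  also have "(\<Sum>k<K. \<Sum>n<N. if n \<in> M k then 0 else g n)
      = (\<Sum>n<N. \<Sum>k<K. if n \<in> M k then 0 else g n)"
    by (rule sum.swap)
  also have "\<dots> = (\<Sum>n<N. (real K - real (replication K M n)) * g n)"
  proof (rule sum.cong)
    fix n
    have "(\<Sum>k<K. if n \<in> M k then 0 else g n) = (\<Sum>k<K. g n) - (\<Sum>k<K. if n \<in> M k then g n else 0)"
      unfolding sum_subtractf[symmetric] by (rule sum.cong) auto
    then show "(\<Sum>k<K. if n \<in> M k then 0 else g n) = (real K - real (replication K M n)) * g n"
      by (simp add: replication_def sum.If_cases Int_def left_diff_distrib)
  qed simp
  finally show ?thesis .
qed

text \<open>This is weak linear programming duality: a block delivers \<open>card (R l)\<close>
  packets of weight at most \<open>1 / card (R l)\<close> each, so it carries weight at most 1,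
  while all required packets have to be delivered.\<close>

lemma blocks_ge_weight:
  fixes g :: "nat \<Rightarrow> real"
  assumes red: "reduce_assignment K Q W"
    and sch: "one_shot_linear_scheme \<tau> K N Q h M W T D R d"
    and nonneg: "\<And>n. 0 \<le> g n"
    and le: "\<And>l p. l < T \<Longrightarrow> p \<in> D l \<Longrightarrow> real (card (R l)) * g (snd p) \<le> 1"
  shows "real (Q div K) * (\<Sum>n<N. (real K - real (replication K M n)) * g n) \<le> real T"
proof -
  have fin: "finite (D l)" and card: "card (D l) = card (R l)" if "l < T" for l
  proof -
    have bij: "bij_betw (d l) (R l) (D l)" and "R l \<subseteq> {..<K}"
      using sch that by (simp_all add: one_shot_linear_scheme_def)
    then have "finite (R l)" using finite_subset[of "R l" "{..<K}"] by simp
    then show "finite (D l)" "card (D l) = card (R l)"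
      using bij_betw_finite[OF bij] bij_betw_same_card[OF bij] by simp_all
  qed
  have "(\<Sum>p\<in>(\<Union>k<K. required N M W k). g (snd p)) \<le> (\<Sum>p\<in>(\<Union>l<T. D l). g (snd p))"
    by (rule sum_mono2) (use sch fin nonneg in \<open>auto simp: one_shot_linear_scheme_def\<close>)
  also have "\<dots> = (\<Sum>l<T. \<Sum>p\<in>D l. g (snd p))"
    by (rule sum.UNION_disjoint)
      (use sch fin in \<open>auto simp: one_shot_linear_scheme_def disjoint_family_on_def\<close>)
  also have "\<dots> \<le> (\<Sum>l<T. 1)"
  proof (rule sum_mono)
    fix l assume "l \<in> {..<T}"
    then have l: "l < T" by simp
    show "(\<Sum>p\<in>D l. g (snd p)) \<le> 1"
    \<comment> \<open>An empty block carries weight 0; otherwise equal shares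
      \<open>1 / card (D l)\<close> add up to 1.\<close>
    proof (cases "D l = {}")
      case False
      then have "0 < card (R l)" using fin[OF l] card[OF l] by (metis card_gt_0_iff)
      then have "g (snd p) \<le> 1 / real (card (D l))" if "p \<in> D l" for p
        using le[OF l that] card[OF l] by (simp add: field_simps)
      then have "(\<Sum>p\<in>D l. g (snd p)) \<le> (\<Sum>p\<in>D l. 1 / real (card (D l)))"
        by (rule sum_mono)
      also have "\<dots> = 1" using False fin[OF l] by simp
      finally show ?thesis .
    qed simp
  qed
  finally show ?thesis unfolding sum_weight_required[OF red] by simp
qed

section \<open>The two lower bounds and their combination\<close>

lemma achievable_ge:
  assumes K: "K \<ge> 1" and N: "N \<ge> 1" and Q: "Q \<ge> 1" and dvd: "K dvd Q"
    and full: "all_submatrices_full_rank K h"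
    and r: "0 < r"
    and ach: "achievable TYPE('t::finite) K N Q h r L"
  shows "L \<ge> (1 - r / real K) / min (real K) (2 * r)"
proof -
  obtain M W T D R d where
    map: "map_assignment K N M" and red: "reduce_assignment K Q W" and
    load: "computation_load K N M = r" and
    sch: "one_shot_linear_scheme TYPE('t) K N Q h M W T D R d" and
    L: "L = real T / (real N * real Q)"
    using ach unfolding achievable_def by blast
  define s where "s n = replication K M n" for n
  have sum_s: "(\<Sum>n<N. real (s n)) = r * real N"
    using load N sum_replication[OF map] unfolding s_def computation_load_def
    by (simp flip: of_nat_sum add: field_simps)
  have R_K: "card (R l) \<le> K" if "l < T" for l
    using sch that card_mono[of "{..<K}" "R l"] by (auto simp: one_shot_linear_scheme_def)
  have R_s: "card (R l) \<le> 2 * s (snd p)" if "l < T" "p \<in> D l" for l p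
    unfolding s_def
    by (rule card_receivers_le[OF full, where D = "D l" and d = "d l"])
      (use sch that in \<open>auto simp: one_shot_linear_scheme_def\<close>)
  \<comment> \<open>A file stored nowhere is required by node 0, hence delivered in a block with a
    receiver, contradicting \<open>card (R l) \<le> 2 * 0\<close>. Positivity matters because the
    convexity estimate divides by \<open>s n\<close>.\<close>
  have s_pos: "0 < s n" if "n < N" for n
  proof (rule ccontr)
    assume "\<not> 0 < s n"
    then have s0: "s n = 0" by simp
    then have "n \<notin> M 0" using K by (auto simp: s_def replication_def)
    have "card (W 0) = Q div K" using red K by (auto simp: reduce_assignment_def)
    then obtain q where "q \<in> W 0"
      using dvd Q by (metis card.empty dvd_div_eq_0_iff ex_in_conv not_one_le_zero)
    then have "(q, n) \<in> required N M W 0" using \<open>n < N\<close> \<open>n \<notin> M 0\<close> by (simp add: required_def)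
    moreover have "required N M W 0 \<subseteq> (\<Union>k<K. required N M W k)"
      using K by (intro UN_upper) simp
    moreover have "(\<Union>k<K. required N M W k) \<subseteq> (\<Union>l<T. D l)"
      using sch by (simp add: one_shot_linear_scheme_def)
    ultimately have "(q, n) \<in> (\<Union>l<T. D l)" by (meson subsetD)
    then obtain l where l: "l < T" "(q, n) \<in> D l" by (elim UN_E) simp
    have bij: "bij_betw (d l) (R l) (D l)" and "R l \<subseteq> {..<K}"
      using sch l(1) by (simp_all add: one_shot_linear_scheme_def)
    then have "finite (R l)" using finite_subset[of "R l" "{..<K}"] by simp
    moreover have "R l \<noteq> {}" using bij_betw_imp_surj_on[OF bij] l(2) by auto
    ultimately show False using R_s[OF l] s0 by simp
  qed
  obtain c where c: "Q = K * c" using dvd by auto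
  then have cpos: "0 < c" using Q by (cases c) auto
  have c': "real (Q div K) = real c" using c K by simp
  \<comment> \<open>The constant weight \<open>1 / K\<close> is admissible because a block has at
    most \<open>K\<close> receivers; the total is affine in \<open>s\<close>, so only its average
    enters.\<close>
  have "real c * (\<Sum>n<N. (real K - real (s n)) * (1 / real K)) \<le> real T"
    unfolding c'[symmetric] s_def
    by (rule blocks_ge_weight[OF red sch]) (use K R_K in \<open>auto simp: field_simps\<close>)
  moreover have "(\<Sum>n<N. (real K - real (s n)) * (1 / real K)) = real N * (1 - r / real K)"
    using K unfolding sum_distrib_right[symmetric] sum_subtractf sum_s
    by (simp add: field_simps)
  ultimately have 1: "real c * (real N * (1 - r / real K)) \<le> real T" by simp
  \<comment> \<open>The weight \<open>1 / (2 * s n)\<close> is admissible by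
    \<open>R_s\<close>.\<close>
  have "real c * (\<Sum>n<N. (real K - real (s n)) * (1 / (2 * real (s n)))) \<le> real T"
    unfolding c'[symmetric] s_def
  proof (rule blocks_ge_weight[OF red sch, where g = "\<lambda>n. 1 / (2 * real (replication K M n))"])
    fix l p assume "l < T" "p \<in> D l"
    then have "real (card (R l)) \<le> 2 * real (s (snd p))" using R_s by fastforce
    then show "real (card (R l)) * (1 / (2 * real (replication K M (snd p)))) \<le> 1"
      by (auto simp: s_def divide_le_eq_1)
  qed simp
  \<comment> \<open>Each term equals \<open>K / (2 * s n) - 1 / 2\<close>, so this is Jensen's
    inequality for \<open>1 / s\<close> at the mean \<open>r\<close>.\<close>
  moreover have "real N * (real K / (2 * r) - 1 / 2)
      \<le> (\<Sum>n<N. (real K - real (s n)) * (1 / (2 * real (s n))))"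
  proof -
    \<comment> \<open>The tangent at \<open>r\<close> lies below the convex function \<open>1 / s\<close>.\<close>
    have "real K / 2 * (2 / r - real (s n) / r\<^sup>2) - 1 / 2
        \<le> (real K - real (s n)) * (1 / (2 * real (s n)))" if "n < N" for n
    proof -
      have sp: "0 < real (s n)" using s_pos[OF that] by simp
      have "1 / real (s n) - (2 / r - real (s n) / r\<^sup>2) = (real (s n) - r)\<^sup>2 / (real (s n) * r\<^sup>2)"
        using sp r by (simp add: field_simps power2_eq_square)
      also have "\<dots> \<ge> 0" using sp by simp
      finally have "real K / 2 * (2 / r - real (s n) / r\<^sup>2) \<le> real K / 2 * (1 / real (s n))"
        by (intro mult_left_mono) auto
      also have "\<dots> = (real K - real (s n)) * (1 / (2 * real (s n))) + 1 / 2"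
        using sp by (simp add: field_simps)
      finally show ?thesis by linarith
    qed
    then have "(\<Sum>n<N. real K / 2 * (2 / r - real (s n) / r\<^sup>2) - 1 / 2)
        \<le> (\<Sum>n<N. (real K - real (s n)) * (1 / (2 * real (s n))))"
      by (intro sum_mono) auto
    moreover have "(\<Sum>n<N. real K / 2 * (2 / r - real (s n) / r\<^sup>2) - 1 / 2)
        = real N * (real K / (2 * r) - 1 / 2)"
    proof -
      \<comment> \<open>The tangent is affine in \<open>s n\<close>, so its sum is determined by
        \<open>sum_s\<close>.\<close>
      have "(\<Sum>n<N. real K / 2 * (2 / r - real (s n) / r\<^sup>2) - 1 / 2)
          = (\<Sum>n<N. (real K / r - 1 / 2) - real K / (2 * r\<^sup>2) * real (s n))"
        by (intro sum.cong) (auto simp: right_diff_distrib)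
      also have "\<dots> = real N * (real K / r - 1 / 2) - real K / (2 * r\<^sup>2) * (r * real N)"
        by (simp only: sum_subtractf sum_s sum_constant card_lessThan right_diff_distrib
            flip: sum_distrib_left)
      also have "real K / (2 * r\<^sup>2) * (r * real N) = real N * (real K / (2 * r))"
        using r by (simp add: power2_eq_square)
      also have "real N * (real K / r - 1 / 2) - real N * (real K / (2 * r))
          = real N * (real K / (2 * r) - 1 / 2)"
        unfolding right_diff_distrib[symmetric] by simp
      finally show ?thesis .
    qed
    ultimately show ?thesis by simp
  qed
  ultimately have 2: "real c * (real N * (real K / (2 * r) - 1 / 2)) \<le> real T"
    by (meson mult_left_mono of_nat_0_le_iff order_trans)
  have pos: "0 < real N * real Q" using N Q by simp
  have K_pos: "0 < real K" and Q_eq: "real Q = real K * real c" using K c by simp_all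
  show ?thesis
  \<comment> \<open>The minimum selects which of the two bounds on \<open>T\<close> is divided by
    \<open>N * Q\<close>, where \<open>Q = K * c\<close>.\<close>
  proof (cases "real K \<le> 2 * r")
    case True
    have eq: "(1 - r / real K) / real K * (real N * real Q) = real c * (real N * (1 - r / real K))"
      using K_pos unfolding Q_eq by simp
    show ?thesis
      unfolding L min_absorb1[OF True] pos_le_divide_eq[OF pos] eq by (rule 1)
  next
    case False
    then have le: "2 * r \<le> real K" by simp
    have "(1 - r / real K) / (2 * r) * real K = real K / (2 * r) - 1 / 2"
      using K_pos r by (simp add: diff_divide_distrib left_diff_distrib)
    from this[symmetric]
    have eq: "(1 - r / real K) / (2 * r) * (real N * real Q)
        = real c * (real N * (real K / (2 * r) - 1 / 2))"
      unfolding Q_eq by (simp only: mult_ac)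
    show ?thesis
      unfolding L min_absorb2[OF le] pos_le_divide_eq[OF pos] eq by (rule 2)
  qed
qed

theorem mainTheorem2:
  fixes K N Q :: nat and h :: "nat \<Rightarrow> nat \<Rightarrow> complex" and r :: real
  assumes "K \<ge> 1" and "N \<ge> K" and "Q \<ge> 1" and "K dvd Q"
    and "all_submatrices_full_rank K h"
    and "1 \<le> r" and "r \<le> real K"
  shows "(\<forall>L. achievable TYPE('t::finite) K N Q h r L
              \<longrightarrow> L \<ge> (1 - r / real K) / min (real K) (2 * r)) \<and>
         comp_comm_function TYPE('t) K N Q h r
           \<ge> ereal ((1 - r / real K) / min (real K) (2 * r))"
proof -
  have "L \<ge> (1 - r / real K) / min (real K) (2 * r)"
    if "achievable TYPE('t) K N Q h r L" for L
    using assms by (intro achievable_ge[OF _ _ _ _ _ _ that]) auto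
  then show ?thesis
    unfolding comp_comm_function_def by (auto intro!: INF_greatest)
qed

end
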